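(* Let $n\ge 2$, let $d$ and $l$ be positive integers, and let $\mathcal{P}^n_d$ be the family of real polynomial functions on $\mathbb{R}^n$ of degree at most $d$. Consider the family $$\mathcal{P}^n_{d,l}=\{V\in\mathcal{C}(\mathbb{R}^n,\mathbb{R})\mid \exists\, V_1,\dots,V_l\in\mathcal{P}^n_d \text{ such that } V(x)\in\{V_1(x),\dots,V_l(x)\}\ \text{ for all } x\in\mathbb{R}^n\},$$ where $\mathcal{C}(\mathbb{R}^n,\mathbb{R})$ is the set of continuous functions from $\mathbb{R}^n$ to $\mathbb{R}$. Then $\mathcal{P}^{n}_{d,l}$ is not a universal class of Lyapunov functions.
   Context: Notation: $\mathbb{R}_+=[0,+\infty)$; $M_n(\mathbb{R})$ is the set of real $n\times n$ matrices. Linear switched systems: for a bounded set $\mathscr{M}\subset M_n(\mathbb{R})$, the linear switched system $(\Sigma_{\mathscr{M}})$ is $\dot x(t)=A(t)x(t)$, $t\ge 0$, $x\in\mathbb{R}^n$, where the switching law $A$ is an arbitrary element of $L^\infty(\mathbb{R}_+,\mathscr{M})$, the space of measurable functions from $\mathbb{R}_+$ to $\mathscr{M}$. For a switching law $A$, $\Phi_A(t,s)$ denotes the fundamental matrix from $s$ to $t$, so that every solution (trajectory) satisfies $x(t)=\Phi_A(t,0)x(0)$. Stability: $(\Sigma_{\mathscr{M}})$ is uniformly exponentially stable if there exist $C,\gamma>0$ such that $\|\Phi_A(t,0)\|\le Ce^{-\gamma t}$ for every switching law $A$ and every $t\ge 0$. Common Lyapunov function: a continuous function $V:\mathbb{R}^n\to\mathbb{R}_+$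 is a common Lyapunov function for $(\Sigma_{\mathscr{M}})$ if it is positive definite (i.e. $V(0)=0$ and $V(x)>0$ for $x\ne 0$) and $V$ is strictly decreasing along each nonzero trajectory of $(\Sigma_{\mathscr{M}})$ (i.e. $t\mapsto V(x(t))$ is strictly decreasing on $\mathbb{R}_+$ for every trajectory $x(\cdot)$ with $x(0)\neq 0$). Universality: a set $\mathcal{P}$ of functions from $\mathbb{R}^n$ to $\mathbb{R}$ is a universal class of Lyapunov functions if for every bounded set $\mathscr{M}\subset M_n(\mathbb{R})$ such that $(\Sigma_{\mathscr{M}})$ is uniformly exponentially stable there exists a common Lyapunov function for $(\Sigma_{\mathscr{M}})$ in $\mathcal{P}$. *)

theory Defs
  imports "HOL-Analysis.Analysis"
begin

(* Caratheodory solutions on [s, oo) of y' = f(t, y), in integral form: by the fundamental theorem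
   of calculus for the Lebesgue integral, these are exactly the locally absolutely continuous y that
   satisfy the equation almost everywhere. The values of y before time s are irrelevant. *)
definition caratheodory_solution ::
    "(real \<Rightarrow> 'a \<Rightarrow> 'a) \<Rightarrow> real \<Rightarrow> (real \<Rightarrow> 'a::euclidean_space) \<Rightarrow> bool" where
  "caratheodory_solution f s y \<longleftrightarrow>
     (\<forall>t\<ge>s. (\<lambda>r. f r (y r)) absolutely_integrable_on {s..t} \<and>
            y t = y s + integral {s..t} (\<lambda>r. f r (y r)))"

(* Only the restriction of A to [0, oo) matters. Essential boundedness is automatic, since M is
   bounded wherever this is used. *)
definition switching_law :: "(real^'n^'n) set \<Rightarrow> (real \<Rightarrow> real^'n^'n) \<Rightarrow> bool" where
  "switching_law M A \<longleftrightarrow>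
     A \<in> borel_measurable (lebesgue_on {0..}) \<and> (\<forall>t\<ge>0. A t \<in> M)"

definition trajectory :: "(real^'n^'n) set \<Rightarrow> (real \<Rightarrow> real^'n) \<Rightarrow> bool" where
  "trajectory M x \<longleftrightarrow>
     (\<exists>A. switching_law M A \<and> caratheodory_solution (\<lambda>t y. A t *v y) 0 x)"

(* Phi t is the fundamental matrix of x' = A(t) x from time s to time t. For a bounded measurable A,
   such a Phi exists and is unique on [s, oo). *)
definition fundamental_matrix_from ::
    "(real \<Rightarrow> real^'n^'n) \<Rightarrow> real \<Rightarrow> (real \<Rightarrow> real^'n^'n) \<Rightarrow> bool" where
  "fundamental_matrix_from A s \<Phi> \<longleftrightarrow>
     caratheodory_solution (\<lambda>t Y. A t ** Y) s \<Phi> \<and> \<Phi> s = mat 1"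

definition uniformly_exponentially_stable :: "(real^'n^'n) set \<Rightarrow> bool" where
  "uniformly_exponentially_stable M \<longleftrightarrow>
     (\<exists>C>0. \<exists>\<gamma>>0. \<forall>A \<Phi>. switching_law M A \<longrightarrow> fundamental_matrix_from A 0 \<Phi> \<longrightarrow>
        (\<forall>t\<ge>0. onorm ((*v) (\<Phi> t)) \<le> C * exp (- \<gamma> * t)))"

definition positive_definite_function :: "(real^'n \<Rightarrow> real) \<Rightarrow> bool" where
  "positive_definite_function V \<longleftrightarrow> V 0 = 0 \<and> (\<forall>x. x \<noteq> 0 \<longrightarrow> V x > 0)"

definition common_lyapunov_function :: "(real^'n^'n) set \<Rightarrow> (real^'n \<Rightarrow> real) \<Rightarrow> bool" where
  "common_lyapunov_function M V \<longleftrightarrow>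
     continuous_on UNIV V \<and> range V \<subseteq> {0..} \<and> positive_definite_function V \<and>
     (\<forall>x. trajectory M x \<longrightarrow> x 0 \<noteq> 0 \<longrightarrow> strict_antimono_on {0..} (\<lambda>t. V (x t)))"

definition universal_lyapunov_class :: "(real^'n \<Rightarrow> real) set \<Rightarrow> bool" where
  "universal_lyapunov_class P \<longleftrightarrow>
     (\<forall>M. bounded M \<longrightarrow> uniformly_exponentially_stable M \<longrightarrow>
        (\<exists>V\<in>P. common_lyapunov_function M V))"

definition multi_indices :: "nat \<Rightarrow> ('n::finite \<Rightarrow> nat) set" where
  "multi_indices d = {\<alpha>. (\<Sum>i\<in>UNIV. \<alpha> i) \<le> d}"

(* The sum in poly_functions is therefore a genuine finite sum. *)
lemma finite_multi_indices: "finite (multi_indices d :: ('n::finite \<Rightarrow> nat) set)"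
proof (rule finite_subset)
  show "(multi_indices d :: ('n \<Rightarrow> nat) set) \<subseteq> (UNIV :: 'n set) \<rightarrow>\<^sub>E {..d}"
  proof
    fix \<alpha> :: "'n \<Rightarrow> nat" assume "\<alpha> \<in> multi_indices d"
    then have "\<alpha> i \<le> d" for i
      using member_le_sum[of i UNIV \<alpha>] by (simp add: multi_indices_def)
    then show "\<alpha> \<in> UNIV \<rightarrow>\<^sub>E {..d}"
      by (simp add: PiE_def)
  qed
  show "finite ((UNIV :: 'n set) \<rightarrow>\<^sub>E {..d})"
    by (simp add: finite_PiE)
qed

definition poly_functions :: "nat \<Rightarrow> (real^'n \<Rightarrow> real) set" where
  "poly_functions d =
     {p. \<exists>c. \<forall>x. p x = (\<Sum>\<alpha>\<in>multi_indices d. c \<alpha> * (\<Prod>i\<in>UNIV. (x $ i) ^ \<alpha> i))}"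

definition piecewise_poly_functions :: "nat \<Rightarrow> nat \<Rightarrow> (real^'n \<Rightarrow> real) set" where
  "piecewise_poly_functions d l =
     {V. continuous_on UNIV V \<and>
         (\<exists>W :: nat \<Rightarrow> real^'n \<Rightarrow> real.
            (\<forall>j\<in>{1..l}. W j \<in> poly_functions d) \<and>
            (\<forall>x. V x \<in> (\<lambda>j. W j x) ` {1..l}))}"

end

theory Submission
  imports Defs
begin

text \<open>
  On the arc \<open>w(t) = t e\<^sub>a + (1 - t\<^sup>2) e\<^sub>b\<close>, place nodes \<open>t\<^sub>j = j / N\<close> and let \<open>\<phi>\<^sub>j\<close> be the functional
  equal to 1 on the chord from \<open>w(t\<^sub>j)\<close> to \<open>w(t\<^sub>j\<^sub>+\<^sub>1)\<close>. The flow \<open>x' = \<phi>\<^sub>j(x) w(e) - (1 + \<epsilon>) x\<close>,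
  with \<open>e\<close> an end of the chord, turns the direction of \<open>x\<close> towards \<open>w(e)\<close>, while \<open>\<phi>\<^sub>j\<close> decays
  only at rate \<open>\<epsilon>\<close>. As the arc bulges above the chord, for small \<open>\<epsilon>\<close> this flow leads from the middle
  of the \<open>j\<close>-th piece of the arc to a point beyond the arc in the direction of a point nearer \<open>w(e)\<close>,
  from where \<open>x' = - (1 + \<epsilon>) x\<close> leads down to the arc. The polyhedral norm
  built from the \<open>\<phi>\<^sub>j\<close> and the coordinates is at most 1 at the nodes by convexity, and therefore decays
  exponentially under arbitrary switching. So a common Lyapunov function has an
  interior bump on each of the \<open>N\<close> pieces, but the number of bumps of a continuous selection from
  \<open>l\<close> polynomials of degree \<open>2 d\<close> is bounded.
\<close>

section \<open>Exponential decay from a finite family of linear functionals\<close>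

lemma continuous_onD_pos:
  fixes h :: "'a::metric_space \<Rightarrow> real"
  assumes "continuous_on S h" "x \<in> S" "h x > 0"
  obtains \<delta> where "\<delta> > 0" "\<And>y. y \<in> S \<Longrightarrow> dist y x < \<delta> \<Longrightarrow> h y > 0"
proof -
  obtain \<delta> where "\<delta> > 0" "\<And>y. y \<in> S \<Longrightarrow> dist y x < \<delta> \<Longrightarrow> dist (h y) (h x) < h x"
    using assms unfolding continuous_on_iff by metis
  then show thesis by (intro that[of \<delta>]) (force simp: dist_real_def)+
qed

text \<open>Suppose some \<open>\<bar>g j\<bar>\<close> meets the barrier
  \<open>b * exp (- (\<epsilon> / 2) * t)\<close> for the first time. All the others are then at
  most the barrier value B, so \<open>\<bar>g j\<bar>\<close> moves with slope at most B - (1 +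
  \<epsilon>) B = - \<epsilon> B, steeper than the slope - (\<epsilon> / 2) B of the barrier. Hence
  it was above the barrier just before. As \<open>k\<close> is merely integrable, slopes are
  compared through integrals over a short interval.\<close>

lemma exponential_barrier:
  fixes g k :: "'i \<Rightarrow> real \<Rightarrow> real"
  assumes fin: "finite I" and "\<epsilon> > 0"
    and int: "\<And>i t. i \<in> I \<Longrightarrow> t \<ge> 0 \<Longrightarrow> k i integrable_on {0..t}"
    and g: "\<And>i t. i \<in> I \<Longrightarrow> t \<ge> 0 \<Longrightarrow> g i t = g i 0 + integral {0..t} (k i)"
    and k: "\<And>i t c. i \<in> I \<Longrightarrow> t \<ge> 0 \<Longrightarrow> (\<And>j. j \<in> I \<Longrightarrow> \<bar>g j t\<bar> \<le> c)
              \<Longrightarrow> \<bar>k i t + (1 + \<epsilon>) * g i t\<bar> \<le> c"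
    and init: "\<And>i. i \<in> I \<Longrightarrow> \<bar>g i 0\<bar> < b"
    and i: "i \<in> I" and t: "t \<ge> 0"
  shows "\<bar>g i t\<bar> < b * exp (- (\<epsilon> / 2) * t)"
proof (rule ccontr)
  assume neg: "\<not> \<bar>g i t\<bar> < b * exp (- (\<epsilon> / 2) * t)"
  define B where "B = (\<lambda>t. b * exp (- (\<epsilon> / 2) * t))"
  have "b > 0" using init[OF i] by linarith
  then have Bpos: "B r > 0" for r by (simp add: B_def)
  have contB: "continuous_on S B" for S unfolding B_def by (intro continuous_intros)
  have contg: "continuous_on {0..s} (g j)" if "j \<in> I" for j s
  proof -
    have "continuous_on {0..s} (\<lambda>r. g j 0 + integral {0..r} (k j))"
    proof (cases "s \<ge> 0")
      case True
      then show ?thesis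
        by (intro continuous_intros indefinite_integral_continuous_1 int that)
    qed simp
    then show ?thesis
      by (rule continuous_on_cong[THEN iffD2, OF refl, rotated]) (rule g[OF that], simp)
  qed
  define S where "S = (\<Union>j\<in>I. {r \<in> {0..t}. B r \<le> \<bar>g j r\<bar>})"
  have "closed S"
    unfolding S_def using fin
  proof (intro closed_UN ballI)
    fix j assume "j \<in> I"
    have "closed {r \<in> {0..t}. B r - \<bar>g j r\<bar> \<le> 0}"
      by (rule continuous_on_closed_Collect_le) (intro continuous_intros contB contg[OF \<open>j \<in> I\<close>], auto)
    then show "closed {r \<in> {0..t}. B r \<le> \<bar>g j r\<bar>}" by simp
  qed
  moreover have "t \<in> S" using neg i t unfolding S_def B_def by (auto simp: not_less)
  moreover have bdd: "bdd_below S" by (rule bdd_belowI[of _ 0]) (auto simp: S_def)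
  ultimately have "Inf S \<in> S" by (intro closed_contains_Inf) auto
  \<comment> \<open>the first time at which some \<open>g i\<close> reaches the barrier\<close>
  define T where "T = Inf S"
  from \<open>Inf S \<in> S\<close> obtain j where j: "j \<in> I" "B T \<le> \<bar>g j T\<bar>" and T: "T \<ge> 0" "T \<le> t"
    by (auto simp: S_def T_def)
  have below: "\<bar>g j' r\<bar> < B r" if "j' \<in> I" "0 \<le> r" "r < T" for j' r
  proof (rule ccontr)
    assume "\<not> ?thesis"
    then have "r \<in> S" using that T by (auto simp: S_def not_less)
    then have "T \<le> r" unfolding T_def using bdd by (rule cInf_lower)
    then show False using that by simp
  qed
  have "T \<noteq> 0" using init[OF j(1)] j(2) by (auto simp: B_def)
  with T have "T > 0" by simp
  have below': "\<bar>g j' r\<bar> \<le> B r" if "j' \<in> I" "0 \<le> r" "r \<le> T" for j' r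
  proof -
    have "\<bar>g j' r\<bar> - B r \<le> 0"
    proof (rule continuous_le_on_closure[where S = "{0..<T}" and f = "\<lambda>r. \<bar>g j' r\<bar> - B r"])
      show "continuous_on (closure {0..<T}) (\<lambda>r. \<bar>g j' r\<bar> - B r)"
        using \<open>T > 0\<close> by (auto intro!: continuous_intros contg that contB)
      show "r \<in> closure {0..<T}" using that \<open>T > 0\<close> by simp
    qed (use below that in force)
    then show ?thesis by simp
  qed
  \<comment> \<open>The fixed sign removes the absolute value: \<open>G\<close> equals
    \<open>\<bar>g j\<bar>\<close> at \<open>T\<close> and is at most \<open>\<bar>g j\<bar>\<close>
    elsewhere.\<close>
  define \<sigma> where "\<sigma> = sgn (g j T)"
  define G where "G = (\<lambda>r. \<sigma> * g j r)"
  have GT: "G T \<ge> B T" using j by (simp add: G_def \<sigma>_def sgn_if abs_if split: if_splits)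
  have \<sigma>: "\<bar>\<sigma>\<bar> \<le> 1" by (simp add: \<sigma>_def sgn_if)
  have G_le: "G r \<le> \<bar>g j r\<bar>" for r
    by (simp add: G_def \<sigma>_def sgn_if abs_ge_self abs_ge_minus_self)
  \<comment> \<open>Half of the margin \<epsilon> is given up so that the inequality is strict at
    \<open>T\<close> and, by continuity, persists shortly before \<open>T\<close>. Together with
    \<open>\<sigma> * k j r + (1 + \<epsilon>) * G r \<le> B r\<close> it bounds the slope of
    \<open>G\<close> by that of \<open>B\<close>.\<close>
  have "(1 + \<epsilon> / 2) * B T < (1 + \<epsilon>) * B T" using Bpos \<open>\<epsilon> > 0\<close> by simp
  also have "\<dots> \<le> (1 + \<epsilon>) * G T" using GT \<open>\<epsilon> > 0\<close> by simp
  finally have pos: "(1 + \<epsilon>) * G T - (1 + \<epsilon> / 2) * B T > 0" by simp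
  have cont: "continuous_on {0..T} (\<lambda>r. (1 + \<epsilon>) * G r - (1 + \<epsilon> / 2) * B r)"
    unfolding G_def by (intro continuous_intros contg contB j)
  have "T \<in> {0..T}" using T by simp
  from continuous_onD_pos[OF cont this pos] obtain \<delta> where "\<delta> > 0"
    and \<delta>: "\<And>r. r \<in> {0..T} \<Longrightarrow> dist r T < \<delta> \<Longrightarrow> (1 + \<epsilon>) * G r - (1 + \<epsilon> / 2) * B r > 0"
    by metis
  define s where "s = max 0 (T - \<delta> / 2)"
  have s: "0 \<le> s" "s < T" "T - s < \<delta>" using \<open>\<delta> > 0\<close> \<open>T > 0\<close> by (auto simp: s_def)
  have intsT: "k j integrable_on {s..T}"
    by (rule integrable_on_subinterval[OF int[OF j(1) T(1)]]) (use s in auto)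
  have "integral {0..s} (k j) + integral {s..T} (k j) = integral {0..T} (k j)"
    by (rule Henstock_Kurzweil_Integration.integral_combine) (use s int[OF j(1) T(1)] in auto)
  then have "G T - G s = \<sigma> * integral {s..T} (k j)"
    using g[OF j(1), of s] g[OF j(1), of T] s T by (simp add: G_def flip: right_diff_distrib)
  also have "\<dots> = integral {s..T} (\<lambda>r. \<sigma> * k j r)" by simp
  also have "\<dots> \<le> integral {s..T} (\<lambda>r. - (\<epsilon> / 2) * B r)"
  proof (rule integral_le)
    show "(\<lambda>r. \<sigma> * k j r) integrable_on {s..T}" using integrable_cmul[OF intsT, of \<sigma>] by simp
    show "(\<lambda>r. - (\<epsilon> / 2) * B r) integrable_on {s..T}"
      by (intro integrable_continuous_real continuous_intros contB)
    fix r assume r: "r \<in> {s..T}"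
    have "\<sigma> * (k j r + (1 + \<epsilon>) * g j r) \<le> \<bar>\<sigma>\<bar> * \<bar>k j r + (1 + \<epsilon>) * g j r\<bar>"
      by (metis abs_ge_self abs_mult)
    also have "\<dots> \<le> 1 * B r"
      by (intro mult_mono \<sigma> k j below') (use r s in auto)
    finally have "\<sigma> * k j r + (1 + \<epsilon>) * G r \<le> B r" by (simp add: G_def algebra_simps)
    moreover have "(1 + \<epsilon>) * G r - (1 + \<epsilon> / 2) * B r > 0"
      by (rule \<delta>) (use r s in \<open>auto simp: dist_real_def\<close>)
    ultimately show "\<sigma> * k j r \<le> - (\<epsilon> / 2) * B r" by (simp add: algebra_simps)
  qed
  also have "\<dots> = B T - B s"
  proof (rule integral_unique, rule fundamental_theorem_of_calculus)
    show "(B has_vector_derivative - (\<epsilon> / 2) * B r) (at r within {s..T})" for r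
      unfolding B_def has_real_derivative_iff_has_vector_derivative[symmetric]
      by (auto intro!: derivative_eq_intros)
  qed (use s in simp)
  finally have "G s \<ge> B s" using GT by simp
  with G_le[of s] below[OF j(1) s(1,2)] show False by simp
qed

text \<open>The maximum of \<open>\<bar>\<psi> \<bullet> x\<bar>\<close> over \<open>F\<close> is a
  polyhedral norm, since \<open>F\<close> contains the coordinate functionals. The last hypothesis
  says that A + (1 + \<epsilon>) I has operator norm at most 1 for it, so the barrier applies to
  every solution \<open>\<Phi> t *v x\<close>.\<close>

lemma uniformly_exponentially_stableI:
  fixes M :: "(real^'n^'n) set" and F :: "(real^'n) set"
  assumes fin: "finite F" and axis: "\<And>i. axis i 1 \<in> F" and "\<epsilon> > 0"
    and M: "\<And>A x c \<psi>. A \<in> M \<Longrightarrow> (\<And>\<psi>. \<psi> \<in> F \<Longrightarrow> \<bar>\<psi> \<bullet> x\<bar> \<le> c) \<Longrightarrow> \<psi> \<in> F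
              \<Longrightarrow> \<bar>\<psi> \<bullet> (A *v x) + (1 + \<epsilon>) * (\<psi> \<bullet> x)\<bar> \<le> c"
  shows "uniformly_exponentially_stable M"
proof -
  \<comment> \<open>The summand 1 gives the strict initial inequality that the barrier requires. The
    dimension factor in \<open>C\<close> comes from bounding the Euclidean norm by the sum of the
    absolute coordinates.\<close>
  define K where "K = 1 + (\<Sum>\<psi>\<in>F. norm \<psi>)"
  define C where "C = real CARD('n) * K"
  have "K > 0" unfolding K_def by (smt (verit) norm_ge_zero sum_nonneg)
  have K: "norm \<psi> < K" if "\<psi> \<in> F" for \<psi>
    using member_le_sum[of \<psi> F norm] that fin by (simp add: K_def)
  have bound: "norm (\<Phi> t *v x) \<le> C * exp (- (\<epsilon> / 2) * t) * norm x"
    if A: "switching_law M A" and \<Phi>: "fundamental_matrix_from A 0 \<Phi>" and t: "t \<ge> 0" for A \<Phi> t x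
  proof (cases "x = 0")
    case False
    have lin: "bounded_linear (\<lambda>Y. \<psi> \<bullet> (Y *v x))" for \<psi> :: "real^'n"
      by (intro bounded_linear_compose[OF bounded_linear_inner_right]) 
         (simp add: linear_linear linear_iff matrix_vector_mult_add_rdistrib scaleR_matrix_vector_assoc)
    have int: "(\<lambda>r. A r ** \<Phi> r) integrable_on {0..t}"
      and eq: "\<Phi> t = mat 1 + integral {0..t} (\<lambda>r. A r ** \<Phi> r)" if "t \<ge> 0" for t
      using \<Phi> that
      by (auto simp: fundamental_matrix_from_def caratheodory_solution_def
               intro: set_lebesgue_integral_eq_integral(1))
    have "\<Phi> 0 = mat 1" using \<Phi> by (simp add: fundamental_matrix_from_def)
    have "\<bar>\<psi> \<bullet> (\<Phi> t *v x)\<bar> < K * norm x * exp (- (\<epsilon> / 2) * t)" if "\<psi> \<in> F" for \<psi>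
    proof (rule exponential_barrier[where I = F and g = "\<lambda>\<psi> t. \<psi> \<bullet> (\<Phi> t *v x)"
          and k = "\<lambda>\<psi> t. \<psi> \<bullet> (A t *v (\<Phi> t *v x))" and \<epsilon> = \<epsilon>])
      fix \<psi> :: "real^'n" and t :: real assume "\<psi> \<in> F" "t \<ge> 0"
      show "(\<lambda>t. \<psi> \<bullet> (A t *v (\<Phi> t *v x))) integrable_on {0..t}"
        using integrable_linear[OF int lin, of t \<psi>] \<open>t \<ge> 0\<close>
        by (simp add: o_def matrix_vector_mul_assoc)
      have "\<psi> \<bullet> (integral {0..t} (\<lambda>r. A r ** \<Phi> r) *v x)
              = integral {0..t} (\<lambda>t. \<psi> \<bullet> (A t *v (\<Phi> t *v x)))"
        using integral_linear[OF int lin, of t \<psi>] \<open>t \<ge> 0\<close>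
        by (simp add: o_def matrix_vector_mul_assoc)
      then show "\<psi> \<bullet> (\<Phi> t *v x)
        = \<psi> \<bullet> (\<Phi> 0 *v x) + integral {0..t} (\<lambda>t. \<psi> \<bullet> (A t *v (\<Phi> t *v x)))"
        using eq[OF \<open>t \<ge> 0\<close>] \<open>\<Phi> 0 = mat 1\<close>
        by (simp add: matrix_vector_mult_add_rdistrib inner_add_right)
    next
      fix \<psi> :: "real^'n" and t c :: real
      assume "\<psi> \<in> F" "t \<ge> 0" "\<And>\<psi>. \<psi> \<in> F \<Longrightarrow> \<bar>\<psi> \<bullet> (\<Phi> t *v x)\<bar> \<le> c"
      then show "\<bar>\<psi> \<bullet> (A t *v (\<Phi> t *v x)) + (1 + \<epsilon>) * (\<psi> \<bullet> (\<Phi> t *v x))\<bar> \<le> c"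
        using A by (intro M) (auto simp: switching_law_def)
    next
      fix \<psi> :: "real^'n" assume "\<psi> \<in> F"
      have "\<bar>\<psi> \<bullet> x\<bar> \<le> norm \<psi> * norm x" by (rule Cauchy_Schwarz_ineq2)
      also have "\<dots> < K * norm x" using K[OF \<open>\<psi> \<in> F\<close>] False by simp
      finally show "\<bar>\<psi> \<bullet> (\<Phi> 0 *v x)\<bar> < K * norm x" by (simp add: \<open>\<Phi> 0 = mat 1\<close>)
    qed (use fin \<open>\<epsilon> > 0\<close> that t in auto)
    from this[OF axis] have "\<bar>(\<Phi> t *v x) $ i\<bar> \<le> K * norm x * exp (- (\<epsilon> / 2) * t)" for i
      by (simp add: inner_axis' less_imp_le)
    then have "(\<Sum>i\<in>UNIV. \<bar>(\<Phi> t *v x) $ i\<bar>) \<le> real CARD('n) * (K * norm x * exp (- (\<epsilon> / 2) * t))"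
      by (intro sum_bounded_above) auto
    then show ?thesis
      using norm_le_l1_cart[of "\<Phi> t *v x"] by (simp add: C_def mult_ac)
  qed simp
  show ?thesis
    unfolding uniformly_exponentially_stable_def
  proof (intro exI conjI allI impI)
    show "C > 0" using \<open>K > 0\<close> by (simp add: C_def)
    show "\<epsilon> / 2 > 0" using \<open>\<epsilon> > 0\<close> by simp
    fix A :: "real \<Rightarrow> real^'n^'n" and \<Phi> :: "real \<Rightarrow> real^'n^'n" and t :: real
    assume "switching_law M A" "fundamental_matrix_from A 0 \<Phi>" "t \<ge> 0"
    then show "onorm ((*v) (\<Phi> t)) \<le> C * exp (- (\<epsilon> / 2) * t)"
      using \<open>K > 0\<close> by (intro onorm_bound bound) (auto simp: C_def)
  qed
qed

section \<open>Two explicit flows and the decrease that they force\<close>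

lemma trajectory_constant_law:
  assumes "A \<in> M" and deriv: "\<And>t. (x has_vector_derivative A *v x t) (at t)"
  shows "trajectory M x"
  unfolding trajectory_def switching_law_def caratheodory_solution_def
proof (intro exI[of _ "\<lambda>_. A"] conjI allI impI)
  have "continuous_on S x" for S
    by (intro continuous_at_imp_continuous_on ballI has_vector_derivative_continuous[OF deriv])
  then have "continuous_on S (\<lambda>t. A *v x t)" for S
    by (rule bounded_linear.continuous_on[OF matrix_vector_mul_bounded_linear])
  then show "(\<lambda>t. A *v x t) absolutely_integrable_on {0..t}" for t
    by (intro absolutely_integrable_continuous_real)
  fix t :: real assume "t \<ge> 0"
  then have "((\<lambda>t. A *v x t) has_integral x t - x 0) {0..t}"
    using deriv by (intro fundamental_theorem_of_calculus) (auto intro: has_vector_derivative_at_within)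
  then show "x t = x 0 + integral {0..t} (\<lambda>t. A *v x t)" by (simp add: integral_unique)
qed (use assms(1) in auto)

text \<open>If \<open>\<phi> \<bullet> v = 1\<close>, then along the flow of this matrix the
  functional \<open>\<phi>\<close> decays at the exact rate \<epsilon>. Taking both vectors to be 0
  gives the pure contraction, so one form covers all generators.\<close>

definition rank_one_generator :: "real \<Rightarrow> real^'n \<Rightarrow> real^'n \<Rightarrow> real^'n^'n" where
  "rank_one_generator \<epsilon> v \<phi> = (\<chi> i j. v $ i * \<phi> $ j) - (1 + \<epsilon>) *\<^sub>R mat 1"

lemma rank_one_generator_mult:
  "rank_one_generator \<epsilon> v \<phi> *v x = (\<phi> \<bullet> x) *\<^sub>R v - (1 + \<epsilon>) *\<^sub>R x"
proof -
  have "(\<chi> i j. v $ i * \<phi> $ j) *v x = (\<phi> \<bullet> x) *\<^sub>R v"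
    by (simp add: vec_eq_iff matrix_vector_mult_def inner_vec_def sum_distrib_left sum_distrib_right mult_ac)
  then show ?thesis
    by (simp add: rank_one_generator_def matrix_vector_mult_diff_rdistrib flip: scaleR_matrix_vector_assoc)
qed

text \<open>The flow from \<open>p\<close> adds multiples of \<open>v\<close> while rescaling, so
  its direction reaches that of \<open>q\<close>. There \<open>\<phi>\<close> has only dropped from
  \<open>\<phi> \<bullet> p\<close> by a factor close to 1 and still exceeds
  \<open>\<phi> \<bullet> q\<close>, so the point is \<kappa> q with \<kappa> > 1, and the
  contraction leads on to \<open>q\<close>. How small \<epsilon> must be depends only on the
  vectors; hence \<open>M\<close> and \<open>V\<close> are quantified inside, and \<open>M\<close>
  may later depend on \<epsilon>.\<close>

lemma lyapunov_decrease:
  fixes v \<phi> p q :: "real^'n"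
  assumes v: "\<phi> \<bullet> v = 1" and q: "q = \<alpha> *\<^sub>R p + \<beta> *\<^sub>R v" and pos: "\<alpha> > 0" "\<beta> > 0"
    and lt: "0 < \<phi> \<bullet> q" "\<phi> \<bullet> q < \<phi> \<bullet> p"
  shows "\<forall>\<^sub>F \<epsilon> in at_right 0. \<forall>M V. common_lyapunov_function M V \<longrightarrow>
    rank_one_generator \<epsilon> v \<phi> \<in> M \<longrightarrow> rank_one_generator \<epsilon> 0 0 \<in> M \<longrightarrow> V q < V p"
proof -
  \<comment> \<open>the time at which the flow from \<open>p\<close> meets the ray through \<open>q\<close>\<close>
  define T where "T = ln ((\<phi> \<bullet> q) / (\<alpha> * (\<phi> \<bullet> p)))"
  have \<phi>q: "\<phi> \<bullet> q = \<alpha> * (\<phi> \<bullet> p) + \<beta>" by (simp add: q v inner_add_right)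
  have p: "\<phi> \<bullet> p > 0" using lt by linarith
  have expT: "exp T = (\<phi> \<bullet> q) / (\<alpha> * (\<phi> \<bullet> p))" using lt p pos by (simp add: T_def)
  have "T > 0" unfolding T_def using p pos by (intro ln_gt_zero) (simp add: \<phi>q)
  \<comment> \<open>For \<epsilon> below this bound,
    \<open>exp (- \<epsilon> * T) * (\<phi> \<bullet> p)\<close> is still larger than
    \<open>\<phi> \<bullet> q\<close>.\<close>
  define \<epsilon>0 where "\<epsilon>0 = ln ((\<phi> \<bullet> p) / (\<phi> \<bullet> q)) / T"
  have "\<epsilon>0 > 0" using \<open>T > 0\<close> lt by (simp add: \<epsilon>0_def)
  show ?thesis
    unfolding eventually_at_right_field
  proof (intro exI[of _ \<epsilon>0] conjI allI impI \<open>\<epsilon>0 > 0\<close>)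
    fix \<epsilon> :: real and M :: "(real^'n^'n) set" and V
    assume \<epsilon>: "0 < \<epsilon>" "\<epsilon> < \<epsilon>0" and V: "common_lyapunov_function M V"
      and M: "rank_one_generator \<epsilon> v \<phi> \<in> M" "rank_one_generator \<epsilon> 0 0 \<in> M"
    have dec: "V (x t) < V (x 0)" if "trajectory M x" "x 0 \<noteq> 0" "t > 0" for x t
      using V that unfolding common_lyapunov_function_def
      by (auto simp: monotone_on_def)
    \<comment> \<open>Variation of constants: as \<open>\<phi> \<bullet> z t\<close> is
      \<open>(\<phi> \<bullet> p) * exp (- \<epsilon> * t)\<close>, the rescaled solution
      \<open>exp ((1 + \<epsilon>) * t) *\<^sub>R z t\<close> has derivative
      \<open>((\<phi> \<bullet> p) * exp t) *\<^sub>R v\<close>.\<close>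
    define z where "z = (\<lambda>t. exp (- (1 + \<epsilon>) * t) *\<^sub>R (p + ((\<phi> \<bullet> p) * (exp t - 1)) *\<^sub>R v))"
    have "trajectory M z"
    proof (rule trajectory_constant_law[OF M(1)])
      fix t
      have "(z has_vector_derivative
          (exp (- (1 + \<epsilon>) * t) * ((\<phi> \<bullet> p) * exp t)) *\<^sub>R v - (1 + \<epsilon>) *\<^sub>R z t) (at t)"
        unfolding z_def by (auto intro!: derivative_eq_intros simp: algebra_simps)
      moreover have "\<phi> \<bullet> z t = exp (- (1 + \<epsilon>) * t) * ((\<phi> \<bullet> p) * exp t)"
        by (simp add: z_def inner_add_right v algebra_simps)
      ultimately show "(z has_vector_derivative rank_one_generator \<epsilon> v \<phi> *v z t) (at t)"
        by (simp only: rank_one_generator_mult)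
    qed
    moreover have "z 0 = p" by (simp add: z_def)
    moreover have "p \<noteq> 0" using p by auto
    ultimately have "V (z T) < V p" using dec[of z T] \<open>T > 0\<close> by simp
    \<comment> \<open>The quotient of the values of \<open>\<phi>\<close> at \<open>z T\<close> and
      at \<open>q\<close>.\<close>
    define \<kappa> where "\<kappa> = exp (- \<epsilon> * T) * ((\<phi> \<bullet> p) / (\<phi> \<bullet> q))"
    have "\<kappa> > 1"
    proof -
      have "\<epsilon> * T < ln ((\<phi> \<bullet> p) / (\<phi> \<bullet> q))"
        using \<epsilon> \<open>T > 0\<close> by (simp add: \<epsilon>0_def pos_less_divide_eq)
      then have "exp (\<epsilon> * T) < (\<phi> \<bullet> p) / (\<phi> \<bullet> q)"
        using lt p by (metis divide_pos_pos exp_less_mono exp_ln)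
      then have "1 < (\<phi> \<bullet> p) / (\<phi> \<bullet> q) / exp (\<epsilon> * T)" by (subst less_divide_eq_1_pos) simp_all
      then show ?thesis by (simp add: \<kappa>_def exp_minus field_simps)
    qed
    have "z T = \<kappa> *\<^sub>R q"
    proof -
      have "exp (- (1 + \<epsilon>) * T) = exp (- \<epsilon> * T) / exp T"
        by (simp add: algebra_simps flip: exp_diff)
      also have "\<dots> = \<kappa> * \<alpha>" using lt p pos by (simp add: expT \<kappa>_def field_simps)
      finally have 1: "exp (- (1 + \<epsilon>) * T) = \<kappa> * \<alpha>" .
      have 2: "\<alpha> * ((\<phi> \<bullet> p) * (exp T - 1)) = \<beta>"
        using pos p by (simp add: expT \<phi>q field_simps)
      have "\<alpha> *\<^sub>R (p + ((\<phi> \<bullet> p) * (exp T - 1)) *\<^sub>R v) = q"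
        unfolding q scaleR_add_right scaleR_scaleR 2 ..
      then show ?thesis unfolding z_def 1 by (metis scaleR_scaleR)
    qed
    define y where "y = (\<lambda>t. exp (- (1 + \<epsilon>) * t) *\<^sub>R (\<kappa> *\<^sub>R q))"
    have "trajectory M y"
    proof (rule trajectory_constant_law[OF M(2)])
      show "(y has_vector_derivative rank_one_generator \<epsilon> 0 0 *v y t) (at t)" for t
        unfolding y_def rank_one_generator_mult by (auto intro!: derivative_eq_intros simp: algebra_simps)
    qed
    moreover have "y 0 = \<kappa> *\<^sub>R q" by (simp add: y_def)
    moreover have "\<kappa> *\<^sub>R q \<noteq> 0" using lt \<open>\<kappa> > 1\<close> by auto
    moreover have "y (ln \<kappa> / (1 + \<epsilon>)) = q"
    proof -
      have "- (1 + \<epsilon>) * (ln \<kappa> / (1 + \<epsilon>)) = - ln \<kappa>" using \<epsilon> by (simp add: field_simps)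
      then have "exp (- (1 + \<epsilon>) * (ln \<kappa> / (1 + \<epsilon>))) = inverse \<kappa>"
        using \<open>\<kappa> > 1\<close> by (simp only: exp_minus) simp
      then show ?thesis unfolding y_def using \<open>\<kappa> > 1\<close> by (simp only:) simp
    qed
    ultimately have "V q < V (\<kappa> *\<^sub>R q)"
      using dec[of y "ln \<kappa> / (1 + \<epsilon>)"] \<epsilon> \<open>\<kappa> > 1\<close> by simp
    with \<open>V (z T) < V p\<close> show "V q < V p" by (simp add: \<open>z T = \<kappa> *\<^sub>R q\<close>)
  qed
qed

section \<open>Geometry of the parabolic arc\<close>

text \<open>A strictly concave graph, hence above its chords, and polynomial in the parameter, so
  that polynomials on the space restrict to polynomials in one variable.\<close>

definition parabola :: "'n \<Rightarrow> 'n \<Rightarrow> real \<Rightarrow> real^'n" where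
  "parabola a b t = t *\<^sub>R axis a 1 + (1 - t\<^sup>2) *\<^sub>R axis b 1"

text \<open>The functional (as a vector) that is 1 on the chord through the points with parameters \<open>r\<close> and \<open>s\<close>.\<close>

definition chord :: "'n \<Rightarrow> 'n \<Rightarrow> real \<Rightarrow> real \<Rightarrow> real^'n" where
  "chord a b r s = (1 / (1 + r * s)) *\<^sub>R ((r + s) *\<^sub>R axis a 1 + axis b 1)"

lemma parabola_nth:
  "a \<noteq> b \<Longrightarrow> parabola a b t $ i = (if i = a then t else if i = b then 1 - t\<^sup>2 else 0)"
  by (simp add: parabola_def axis_def)

text \<open>The correction term vanishes at the two ends of the chord. Its sign shows that the
  functional exceeds 1 strictly between them, which is the bulge, and is at most 1 at all other
  parameters, which is what the nodes need.\<close>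

lemma chord_parabola:
  assumes "a \<noteq> b" "0 \<le> r" "0 \<le> s"
  shows "chord a b r s \<bullet> parabola a b t = 1 - (t - r) * (t - s) / (1 + r * s)"
proof -
  have "chord a b r s \<bullet> parabola a b t = ((r + s) * t + (1 - t\<^sup>2)) / (1 + r * s)"
    using assms by (simp add: chord_def parabola_def inner_add_left inner_add_right inner_axis_axis)
       (simp add: add_divide_distrib diff_divide_distrib algebra_simps)
  moreover have "1 + r * s > 0" using assms by (simp add: add_pos_nonneg)
  ultimately show ?thesis by (simp add: field_simps power2_eq_square)
qed

text \<open>Cramer's rule in the plane of the two axes: the determinant of the points with
  parameters x and y is (x - y) (1 + x y).\<close>

lemma parabola_combination:
  assumes "a \<noteq> b" "(p - v) * (1 + p * v) \<noteq> 0"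
  shows "parabola a b q
    = ((q - v) * (1 + q * v) / ((p - v) * (1 + p * v))) *\<^sub>R parabola a b p
      + ((p - q) * (1 + p * q) / ((p - v) * (1 + p * v))) *\<^sub>R parabola a b v"
proof -
  have "q * ((p - v) * (1 + p * v)) = (q - v) * (1 + q * v) * p + (p - q) * (1 + p * q) * v"
    "(1 - q\<^sup>2) * ((p - v) * (1 + p * v))
       = (q - v) * (1 + q * v) * (1 - p\<^sup>2) + (p - q) * (1 + p * q) * (1 - v\<^sup>2)"
    by algebra+
  then have "q = ((q - v) * (1 + q * v) * p + (p - q) * (1 + p * q) * v) / ((p - v) * (1 + p * v))"
    "1 - q\<^sup>2 = ((q - v) * (1 + q * v) * (1 - p\<^sup>2) + (p - q) * (1 + p * q) * (1 - v\<^sup>2))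
        / ((p - v) * (1 + p * v))"
    using assms(2) by (simp_all only: eq_divide_eq if_False if_True not_False_eq_True)
  then show ?thesis
    using assms(1) by (simp add: vec_eq_iff parabola_nth add_divide_distrib)
qed

text \<open>The target parameter lies strictly between \<open>m\<close> and \<open>e\<close>, which
  makes both coefficients of the combination positive; and the excess over the chord is largest at
  the midpoint \<open>m\<close>, so the functional is smaller at the target.\<close>

lemma lyapunov_decrease_parabola:
  assumes ab: "a \<noteq> b" and rs: "0 \<le> r" "r < s" and e: "e \<in> {r, s}"
    and m: "m = (r + s) / 2"
  shows "\<forall>\<^sub>F \<epsilon> in at_right 0. \<forall>M V. common_lyapunov_function M V \<longrightarrow>
    rank_one_generator \<epsilon> (parabola a b e) (chord a b r s) \<in> M \<longrightarrow>
    rank_one_generator \<epsilon> 0 0 \<in> M \<longrightarrow> V (parabola a b ((m + e) / 2)) < V (parabola a b m)"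
proof (rule lyapunov_decrease)
  define q where "q = (m + e) / 2"
  have nonneg: "m \<ge> 0" "e \<ge> 0" "q \<ge> 0" using rs e m by (auto simp: q_def)
  then have pos: "1 + q * e > 0" "1 + m * e > 0" "1 + m * q > 0" by (simp_all add: add_pos_nonneg)
  have "m \<noteq> e" using rs e m by auto
  show "chord a b r s \<bullet> parabola a b e = 1"
    using e rs ab by (auto simp: chord_parabola)
  show "parabola a b ((m + e) / 2)
    = ((q - e) * (1 + q * e) / ((m - e) * (1 + m * e))) *\<^sub>R parabola a b m
      + ((m - q) * (1 + m * q) / ((m - e) * (1 + m * e))) *\<^sub>R parabola a b e"
    unfolding q_def[symmetric] using \<open>m \<noteq> e\<close> pos ab by (intro parabola_combination) auto
  have half: "q - e = (m - e) / 2" "m - q = (m - e) / 2" by (simp_all add: q_def field_simps)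
  show "(q - e) * (1 + q * e) / ((m - e) * (1 + m * e)) > 0"
    "(m - q) * (1 + m * q) / ((m - e) * (1 + m * e)) > 0"
    unfolding half using \<open>m \<noteq> e\<close> pos by simp_all
  \<comment> \<open>The target divides the parameter interval in the ratio 1 to 3 and the midpoint
    halves it, whence 1/4 * 3/4 and 1/2 * 1/2.\<close>
  have "(q - r) * (q - s) = - 3 / 16 * (s - r)\<^sup>2" "(m - r) * (m - s) = - 1 / 4 * (s - r)\<^sup>2"
    using e by (auto simp: q_def m power2_eq_square field_simps)
  moreover define E where "E = (s - r)\<^sup>2 / (1 + r * s)"
  moreover have "1 + r * s > 0" using rs by (simp add: add_pos_nonneg)
  then have "E > 0" unfolding E_def using rs by simp
  ultimately have "(q - r) * (q - s) / (1 + r * s) = - 3 / 16 * E"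
    "(m - r) * (m - s) / (1 + r * s) = - 1 / 4 * E" by simp_all
  then have "chord a b r s \<bullet> parabola a b q = 1 + 3 / 16 * E"
    "chord a b r s \<bullet> parabola a b m = 1 + 1 / 4 * E"
    using rs ab by (simp_all add: chord_parabola)
  then show "0 < chord a b r s \<bullet> parabola a b ((m + e) / 2)"
    "chord a b r s \<bullet> parabola a b ((m + e) / 2) < chord a b r s \<bullet> parabola a b m"
    unfolding q_def[symmetric] using \<open>E > 0\<close> by simp_all
qed

section \<open>Counting the bumps of a continuous selection of polynomials\<close>

lemma poly_functions_on_parabola:
  fixes a b :: "'n::finite"
  assumes "a \<noteq> b" and "W \<in> poly_functions d"
  obtains p where "degree p \<le> 2 * d" "\<And>t. W (parabola a b t) = poly p t"
proof -
  from assms(2) obtain c where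
    c: "\<And>x. W x = (\<Sum>\<alpha>\<in>multi_indices d. c \<alpha> * (\<Prod>i\<in>UNIV. (x $ i) ^ \<alpha> i))"
    by (auto simp: poly_functions_def)
  define L :: "'n \<Rightarrow> real poly"
    where "L = (\<lambda>i. if i = a then [:0, 1:] else if i = b then [:1, 0, -1:] else 0)"
  have L: "poly (L i) t = parabola a b t $ i" for i t
    using \<open>a \<noteq> b\<close> by (simp add: L_def parabola_nth power2_eq_square)
  have deg: "degree (L i) \<le> 2" for i by (simp add: L_def)
  define p where "p = (\<Sum>\<alpha>\<in>multi_indices d. smult (c \<alpha>) (\<Prod>i\<in>UNIV. L i ^ \<alpha> i))"
  show thesis
  proof
    show "W (parabola a b t) = poly p t" for t
      by (simp add: c p_def poly_sum poly_prod L)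
    show "degree p \<le> 2 * d"
      unfolding p_def
    proof (intro degree_sum_le finite_multi_indices)
      fix \<alpha> :: "'n \<Rightarrow> nat" assume \<alpha>: "\<alpha> \<in> multi_indices d"
      have "degree (smult (c \<alpha>) (\<Prod>i\<in>UNIV. L i ^ \<alpha> i)) \<le> degree (\<Prod>i\<in>UNIV. L i ^ \<alpha> i)"
        by (rule degree_smult_le)
      also have "\<dots> \<le> (\<Sum>i\<in>UNIV. degree (L i ^ \<alpha> i))"
        using degree_prod_sum_le[of UNIV "\<lambda>i. L i ^ \<alpha> i"] by (simp add: o_def)
      also have "\<dots> \<le> (\<Sum>i\<in>UNIV. 2 * \<alpha> i)"
        by (intro sum_mono order.trans[OF degree_power_le] mult_right_mono deg) simp
      also have "\<dots> \<le> 2 * d"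
        using \<alpha> by (simp add: multi_indices_def flip: sum_distrib_left)
      finally show "degree (smult (c \<alpha>) (\<Prod>i\<in>UNIV. L i ^ \<alpha> i)) \<le> 2 * d" .
    qed
  qed
qed

text \<open>Without a crossing of two distinct pieces in the interval, continuity forces
  \<open>f\<close> to follow a single polynomial there. The bump then makes the derivative of that
  polynomial change sign, so it has a zero.\<close>

lemma piecewise_poly_bump:
  fixes f :: "real \<Rightarrow> real" and P :: "real poly set"
  assumes cont: "continuous_on UNIV f" and "finite P" and f: "\<And>t. f t \<in> (\<lambda>p. poly p t) ` P"
    and bump: "r < u" "u < m" "m < v" "v < s" "f u < f m" "f v < f m"
  shows "\<exists>z\<in>{r<..<s}. (\<exists>p\<in>P. \<exists>q\<in>P. p \<noteq> q \<and> poly (p - q) z = 0) \<or>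
                         (\<exists>p\<in>P. pderiv p \<noteq> 0 \<and> poly (pderiv p) z = 0)"
proof (rule ccontr)
  assume neg: "\<not> ?thesis"
  obtain p where p: "p \<in> P" "f m = poly p m" using f[of m] by auto
  \<comment> \<open>\<open>A\<close> and \<open>B\<close> are closed and cover the interval; a
    common point in it would be a crossing. Connectedness therefore leaves \<open>B\<close> no point
    in the interval.\<close>
  define A where "A = {t. f t = poly p t}"
  define B where "B = (\<Union>q\<in>P - {p}. {t. f t = poly q t})"
  have "closed {t. f t = poly q t}" for q
    by (intro closed_Collect_eq cont) (auto intro!: continuous_intros)
  then have "closed A" "closed B" using \<open>finite P\<close> by (auto simp: A_def B_def)
  moreover have "{r<..<s} \<subseteq> A \<union> B" using f by (auto simp: A_def B_def)
  moreover have "A \<inter> B \<inter> {r<..<s} = {}" using neg p by (fastforce simp: A_def B_def)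
  moreover have "m \<in> A \<inter> {r<..<s}" using p bump by (auto simp: A_def)
  ultimately have "B \<inter> {r<..<s} = {}"
    using connected_Ioo[of r s] unfolding connected_closed by blast
  then have fp: "f t = poly p t" if "t \<in> {r<..<s}" for t
    using that \<open>{r<..<s} \<subseteq> A \<union> B\<close> unfolding A_def by blast
  have lt: "poly p u < poly p m" "poly p v < poly p m" using fp bump by auto
  obtain x where x: "u < x" "x < m" "poly p m - poly p u = (m - u) * poly (pderiv p) x"
    using poly_MVT[of u m p] bump by auto
  obtain y where y: "m < y" "y < v" "poly p v - poly p m = (v - m) * poly (pderiv p) y"
    using poly_MVT[of m v p] bump by auto
  have "poly (pderiv p) x > 0" using x lt bump by (smt (verit) mult_nonneg_nonpos)
  moreover have "poly (pderiv p) y < 0" using y lt bump by (smt (verit) mult_nonneg_nonneg)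
  ultimately obtain z where "x < z" "z < y" "poly (pderiv p) z = 0"
    using poly_IVT_neg[of x y "pderiv p"] x y by auto
  moreover have "pderiv p \<noteq> 0" using \<open>poly (pderiv p) x > 0\<close> by auto
  ultimately show False using neg p x y bump by force
qed

text \<open>Each bump yields a root of a difference of pieces or of a derivative. The open intervals
  are disjoint, so these roots are distinct, and every polynomial concerned has at most
  \<open>D\<close> roots.\<close>

lemma card_bumps_le:
  fixes f :: "real \<Rightarrow> real" and P :: "real poly set"
  assumes "continuous_on UNIV f" and fin: "finite P" and "\<And>t. f t \<in> (\<lambda>p. poly p t) ` P"
    and deg: "\<And>p. p \<in> P \<Longrightarrow> degree p \<le> D"
    and t: "mono t"
    and bump: "\<And>j. j < N \<Longrightarrow> \<exists>u m v. t j < u \<and> u < m \<and> m < v \<and> v < t (Suc j) \<and> f u < f m \<and> f v < f m"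
  shows "N \<le> card P * card P * D + card P * D"
proof -
  define R where "R = (\<lambda>q :: real poly. if q = 0 then {} else {z. poly q z = 0})"
  \<comment> \<open>The zero polynomial is assigned no roots, which keeps \<open>R\<close> finite on
    pairs p = q and on derivatives of constants.\<close>
  have finR: "finite (R q)" for q by (simp add: R_def poly_roots_finite)
  have cardR: "card (R q) \<le> D" if "degree q \<le> D" for q
    using that card_poly_roots_bound[of q] by (auto simp: R_def intro: order.trans)
  define Z where "Z = (\<Union>(p, q)\<in>P \<times> P. R (p - q)) \<union> (\<Union>p\<in>P. R (pderiv p))"
  have finZ: "finite Z" using fin finR by (auto simp: Z_def)
  have "\<exists>z\<in>Z. z \<in> {t j<..<t (Suc j)}" if j: "j < N" for j
  proof -
    obtain u m v where "t j < u" "u < m" "m < v" "v < t (Suc j)" "f u < f m" "f v < f m"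
      using bump[OF j] by blast
    from piecewise_poly_bump[OF assms(1-3) this] obtain z where z: "z \<in> {t j<..<t (Suc j)}"
      and "(\<exists>p\<in>P. \<exists>q\<in>P. p \<noteq> q \<and> poly (p - q) z = 0) \<or> (\<exists>p\<in>P. pderiv p \<noteq> 0 \<and> poly (pderiv p) z = 0)"
      by blast
    then have "(\<exists>p\<in>P. \<exists>q\<in>P. z \<in> R (p - q)) \<or> (\<exists>p\<in>P. z \<in> R (pderiv p))"
      by (auto simp: R_def)
    then have "z \<in> Z" by (auto simp: Z_def)
    with z show ?thesis by blast
  qed
  then obtain z where z: "\<And>j. j < N \<Longrightarrow> z j \<in> Z \<and> z j \<in> {t j<..<t (Suc j)}" by metis
  have "inj_on z {..<N}"
  proof (rule linorder_inj_onI')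
    fix i j assume "i \<in> {..<N}" "j \<in> {..<N}" "i < j"
    then have "z i < t (Suc i)" "t (Suc i) \<le> t j" "t j < z j"
      using z monoD[OF t, of "Suc i" j] by auto
    then show "z i \<noteq> z j" by simp
  qed
  then have "N \<le> card Z"
    using card_inj_on_le[of z "{..<N}" Z] z finZ by auto
  also have "\<dots> \<le> card (\<Union>(p, q)\<in>P \<times> P. R (p - q)) + card (\<Union>p\<in>P. R (pderiv p))"
    unfolding Z_def by (rule card_Un_le)
  also have "card (\<Union>(p, q)\<in>P \<times> P. R (p - q)) \<le> (\<Sum>(p, q)\<in>P \<times> P. card (R (p - q)))"
    using card_UN_le[of "P \<times> P" "\<lambda>(p, q). R (p - q)"] fin by (simp add: case_prod_unfold)
  also have "\<dots> \<le> (\<Sum>(p, q)\<in>P \<times> P. D)"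
    by (intro sum_mono) (auto intro: cardR degree_diff_le deg)
  also have "\<dots> = card P * card P * D" by (simp add: case_prod_unfold card_cartesian_product)
  also have "card (\<Union>p\<in>P. R (pderiv p)) \<le> (\<Sum>p\<in>P. card (R (pderiv p)))"
    using fin by (rule card_UN_le)
  also have "\<dots> \<le> (\<Sum>p\<in>P. D)"
    using deg by (intro sum_mono cardR) (auto simp: degree_pderiv intro: order.trans[OF diff_le_self])
  also have "\<dots> = card P * D" by simp
  finally show ?thesis by simp
qed

section \<open>The switched system and the contradiction\<close>

theorem theorem4p9:
  fixes d l :: nat
  assumes "CARD('n::finite) \<ge> 2" and "d > 0" and "l > 0"
  shows "\<not> universal_lyapunov_class (piecewise_poly_functions d l :: (real^'n \<Rightarrow> real) set)"
proof
  assume univ: "universal_lyapunov_class (piecewise_poly_functions d l :: (real^'n \<Rightarrow> real) set)"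
  obtain a b :: 'n where ab: "a \<noteq> b"
    using assms(1) card_le_Suc0_iff_eq[of "UNIV :: 'n set"] by fastforce
  \<comment> \<open>One more than the number of bumps possible for \<open>l\<close> pieces of degree
    at most \<open>2 * d\<close>.\<close>
  define N where "N = Suc (l * l * (2 * d) + l * (2 * d))"
  define t where "t = (\<lambda>j. real j / real N)"
  have "N > 0" by (simp add: N_def)
  have t: "0 \<le> t j" "t j < t (Suc j)" for j using \<open>N > 0\<close> by (auto simp: t_def divide_strict_right_mono)
  have t1: "t j \<le> 1" if "j \<le> N" for j using that \<open>N > 0\<close> by (simp add: t_def)
  have "mono t" using t(2) by (simp add: mono_iff_le_Suc less_imp_le)
  define \<phi> where "\<phi> = (\<lambda>j. chord a b (t j) (t (Suc j)))"
  define w where "w = parabola a b"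
  define mid where "mid = (\<lambda>j. (t j + t (Suc j)) / 2)"
  define M where "M = (\<lambda>\<epsilon>. insert (rank_one_generator \<epsilon> 0 0)
    (\<Union>j<N. (\<lambda>e. rank_one_generator \<epsilon> (w e) (\<phi> j)) ` {t j, t (Suc j)}))"
  \<comment> \<open>Only finitely many pairs of a piece and an end occur, so one \<epsilon> serves
    them all; the inner quantifier over sets is then instantiated with
    \<open>M \<epsilon>\<close>.\<close>
  have "\<forall>\<^sub>F \<epsilon> in at_right 0. \<forall>j\<in>{..<N}. \<forall>e\<in>{t j, t (Suc j)}.
      \<forall>M V. common_lyapunov_function M V \<longrightarrow> rank_one_generator \<epsilon> (w e) (\<phi> j) \<in> M \<longrightarrow>
        rank_one_generator \<epsilon> 0 0 \<in> M \<longrightarrow> V (w ((mid j + e) / 2)) < V (w (mid j))"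
    unfolding w_def \<phi>_def mid_def
    by (intro eventually_ball_finite ballI finite.intros finite_lessThan lyapunov_decrease_parabola ab t) auto
  then have "\<forall>\<^sub>F \<epsilon> in at_right (0 :: real). \<epsilon> > 0 \<and> (\<forall>j\<in>{..<N}. \<forall>e\<in>{t j, t (Suc j)}.
      \<forall>V. common_lyapunov_function (M \<epsilon>) V \<longrightarrow> V (w ((mid j + e) / 2)) < V (w (mid j)))"
    using eventually_at_right_less[of 0]
  proof eventually_elim
    case (elim \<epsilon>)
    show ?case
    proof (intro conjI ballI allI impI elim(2))
      fix j e V assume "j \<in> {..<N}" "e \<in> {t j, t (Suc j)}" "common_lyapunov_function (M \<epsilon>) V"
      moreover from this have "rank_one_generator \<epsilon> (w e) (\<phi> j) \<in> M \<epsilon>" "rank_one_generator \<epsilon> 0 0 \<in> M \<epsilon>"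
        by (auto simp: M_def)
      ultimately show "V (w ((mid j + e) / 2)) < V (w (mid j))" using elim(1) by blast
    qed
  qed
  then obtain \<epsilon> where "\<epsilon> > 0" and dec: "\<And>j e V. j < N \<Longrightarrow> e \<in> {t j, t (Suc j)}
      \<Longrightarrow> common_lyapunov_function (M \<epsilon>) V \<Longrightarrow> V (w ((mid j + e) / 2)) < V (w (mid j))"
    using eventually_happens'[OF trivial_limit_at_right_real] by (smt (verit) lessThan_iff)
  define F where "F = \<phi> ` {..<N} \<union> range (\<lambda>i. axis i 1)"
  have node: "\<bar>\<psi> \<bullet> w (t k)\<bar> \<le> 1" if "\<psi> \<in> F" "k \<le> N" for \<psi> k
    using that(1) unfolding F_def
  proof (elim UnE imageE)
    fix i assume "\<psi> = axis i 1"
    then show ?thesis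
      using t(1)[of k] t1[OF that(2)] ab by (simp add: w_def parabola_nth inner_axis' power_le_one)
  next
    fix j assume j: "\<psi> = \<phi> j" "j \<in> {..<N}"
    \<comment> \<open>No node lies strictly between two consecutive ones, so the two factors never
      have opposite signs. All nodes involved lie in [0, 1], so the product is at most 1 and the
      chord functional has a value in [0, 1] at each node.\<close>
    have "0 \<le> (t k - t j) * (t k - t (Suc j))"
      using monoD[OF \<open>mono t\<close>, of k j] monoD[OF \<open>mono t\<close>, of "Suc j" k] t(2)[of j]
      by (cases "k \<le> j") (auto intro: mult_nonneg_nonneg mult_nonpos_nonpos)
    moreover have "\<bar>t k - t j\<bar> * \<bar>t k - t (Suc j)\<bar> \<le> 1 * 1"
      using t(1)[of k] t(1)[of j] t(1)[of "Suc j"] t1[OF that(2)] t1[of j] t1[of "Suc j"] j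
      by (intro mult_mono) auto
    ultimately have "0 \<le> (t k - t j) * (t k - t (Suc j))" "(t k - t j) * (t k - t (Suc j)) \<le> 1"
      by (simp_all flip: abs_mult)
    moreover have "1 + t j * t (Suc j) \<ge> 1" using t(1) by simp
    ultimately have "0 \<le> (t k - t j) * (t k - t (Suc j)) / (1 + t j * t (Suc j))"
      "(t k - t j) * (t k - t (Suc j)) / (1 + t j * t (Suc j)) \<le> 1"
      by (simp_all add: divide_le_eq)
    then show ?thesis
      using t(1) ab by (simp add: j w_def \<phi>_def chord_parabola)
  qed
  have "uniformly_exponentially_stable (M \<epsilon>)"
  proof (rule uniformly_exponentially_stableI)
    show "finite F" by (simp add: F_def)
    show "axis i 1 \<in> F" for i by (simp add: F_def)
    fix A x c \<psi>
    assume A: "A \<in> M \<epsilon>" and x: "\<And>\<psi>. \<psi> \<in> F \<Longrightarrow> \<bar>\<psi> \<bullet> x\<bar> \<le> c" and \<psi>: "\<psi> \<in> F"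
    have "c \<ge> 0" using x[OF \<psi>] by linarith
    from A consider "A = rank_one_generator \<epsilon> 0 0"
      | j k where "j < N" "k \<in> {j, Suc j}" "A = rank_one_generator \<epsilon> (w (t k)) (\<phi> j)"
      unfolding M_def by blast
    then show "\<bar>\<psi> \<bullet> (A *v x) + (1 + \<epsilon>) * (\<psi> \<bullet> x)\<bar> \<le> c"
    proof cases
      case 1
      then show ?thesis using \<open>c \<ge> 0\<close> by (simp add: rank_one_generator_mult)
    next
      case 2
      \<comment> \<open>Here \<open>A *v x + (1 + \<epsilon>) *\<^sub>R x\<close> is
        \<open>(\<phi> j \<bullet> x) *\<^sub>R w (t k)\<close>, and \<open>w (t k)\<close> lies in
        the unit ball of the polyhedral norm.\<close>
      have "\<bar>\<phi> j \<bullet> x\<bar> * \<bar>\<psi> \<bullet> w (t k)\<bar> \<le> c * 1"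
        using 2 \<open>c \<ge> 0\<close> by (intro mult_mono x node \<psi>) (auto simp: F_def)
      then show ?thesis by (simp add: 2 rank_one_generator_mult inner_diff_right abs_mult)
    qed
  qed fact
  moreover have "bounded (M \<epsilon>)" by (rule finite_imp_bounded) (auto simp: M_def)
  ultimately obtain V where V: "V \<in> piecewise_poly_functions d l" "common_lyapunov_function (M \<epsilon>) V"
    using univ by (auto simp: universal_lyapunov_class_def)
  from V(1) obtain W :: "nat \<Rightarrow> real^'n \<Rightarrow> real" where contV: "continuous_on UNIV V"
    and W: "\<And>j. j \<in> {1..l} \<Longrightarrow> W j \<in> poly_functions d" and VW: "\<And>x. V x \<in> (\<lambda>j. W j x) ` {1..l}"
    unfolding piecewise_poly_functions_def by blast
  have "\<forall>j\<in>{1..l}. \<exists>p. degree p \<le> 2 * d \<and> (\<forall>t. W j (w t) = poly p t)"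
    using poly_functions_on_parabola[OF ab W] unfolding w_def by metis
  then obtain p where p: "\<And>j. j \<in> {1..l} \<Longrightarrow> degree (p j) \<le> 2 * d"
    "\<And>j t. j \<in> {1..l} \<Longrightarrow> W j (w t) = poly (p j) t" by metis
  define P where "P = p ` {1..l}"
  have "card P \<le> l" using card_image_le[of "{1..l}" p] by (simp add: P_def)
  have "N \<le> card P * card P * (2 * d) + card P * (2 * d)"
  proof (rule card_bumps_le[where f = "\<lambda>t. V (w t)"])
    show "continuous_on UNIV (\<lambda>t. V (w t))"
      unfolding w_def parabola_def
      by (intro continuous_on_compose2[OF contV] continuous_intros) auto
    show "V (w t) \<in> (\<lambda>p. poly p t) ` P" for t
      using VW[of "w t"] p(2) by (auto simp: P_def)
    fix j assume "j < N"
    \<comment> \<open>The flows towards both ends of the chord give a smaller value on either side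
      of the midpoint, which is the bump.\<close>
    then have "V (w ((mid j + t j) / 2)) < V (w (mid j))" "V (w ((mid j + t (Suc j)) / 2)) < V (w (mid j))"
      using dec V(2) by auto
    moreover have "t j < mid j" "mid j < t (Suc j)" using t(2)[of j] by (auto simp: mid_def)
    ultimately show "\<exists>u m v. t j < u \<and> u < m \<and> m < v \<and> v < t (Suc j) \<and> V (w u) < V (w m) \<and> V (w v) < V (w m)"
      by (intro exI[of _ "(mid j + t j) / 2"] exI[of _ "mid j"] exI[of _ "(mid j + t (Suc j)) / 2"]) simp
  qed (use \<open>mono t\<close> p(1) in \<open>auto simp: P_def\<close>)
  also have "\<dots> \<le> l * l * (2 * d) + l * (2 * d)"
    using \<open>card P \<le> l\<close> by (intro add_mono mult_mono) auto
  finally show False by (simp add: N_def)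
qed

end
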